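(* Let $n\geq3$. Let $A=(000;0101)$ and $B=(000;1212)$, read in the fixed coordinate copy of $Q_3$ in $Q_n$, and let $w_{AB}=AB$, $w_{BA}=BA$ be the concatenations. Then, as based closed walks on $Q_n$, $w_{AB}$ and $w_{BA}$ have the same directed transition counts but different reduced loop words: $$\tau_{w_{AB}}=\tau_{w_{BA}},\qquad \rho_{T_n}(w_{AB})\neq\rho_{T_n}(w_{BA}).$$ Therefore, for no $n\ge3$ do the directed transition counts of a based closed walk on $Q_n$ determine its reduced loop word.
   Context: $Q_n$ is the $1$-skeleton (graph) of the $n$-dimensional cube: vertex set $\{0,1\}^n$, two vertices adjacent iff they differ in exactly one coordinate. Its cycle rank is $r_n=(n-2)2^{n-1}+1$, and $F_{r_n}$ is the free group of rank $r_n$. For $Q_3$, coordinates are numbered $0,1,2$, a vertex is written $b_2b_1b_0$ ($b_i$ the $i$-th coordinate) and identified with the integer $4b_2+2b_1+b_0$. The notation $(000;a_1\cdots a_m)$ denotes the walk starting at $000$ whose $k$-th step flips coordinate $a_k\in\{0,1,2\}$. The Gray spanning tree of $Q_3$ is the path $000,001,011,010,110,111,101,100$ (i.e. $0,1,3,2,6,7,5,4$); its cotree edges $(0,2),(0,4),(1,5),(3,7),(4,6)$ are oriented from the smaller to the larger integer. Fix a coordinate copy of $Q_3$ in $Q_n$ (three coordinates vary, the others are held constant), with basepoint of $Q_n$ the vertex corresponding to $000$, and a spanning tree $T_n$ of $Q_n$ extending the Gray spanning tree of this copy. The $r_n$ edges of $Q_n$ not in $T_n$ (cotree edges) are each given a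 fixed orientation, the five cotree edges lying in the copy of $Q_3$, which correspond to $(0,2),(0,4),(1,5),(3,7),(4,6)$, being oriented from the vertex corresponding to the smaller integer to the vertex corresponding to the larger integer, and are identified with a free basis of $F_{r_n}$. For a based closed walk $w$ on $Q_n$, reading its steps in order, a forward crossing of a cotree edge contributes the corresponding basis element, a backward crossing its inverse, and a tree edge contributes nothing; the reduced loop word $\rho_{T_n}(w)\in F_{r_n}$ is the free reduction of the resulting word. For a walk $w$ with vertex sequence $v_0,\ldots,v_m$, the directed transition count is $\tau_w(p,q)=\#\{k:1\le k\le m,\ (v_{k-1},v_k)=(p,q)\}$ for vertices $p,q$. *)

theory Defs
  imports "Graph_Theory.Graph_Theory"
begin

section \<open>Cubes\<close>

text \<open>Undirected graphs are symmetric digraphs: an edge is a pair of opposite arcs.\<close>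

definition cube :: "nat \<Rightarrow> bool list pair_pre_digraph" where
  "cube n = \<lparr> pverts = {v. length v = n},
              parcs = {(u, v). length u = n \<and> length v = n \<and> (\<exists>!i. i < n \<and> u ! i \<noteq> v ! i)} \<rparr>"

definition flip :: "nat \<Rightarrow> bool list \<Rightarrow> bool list" where
  "flip a v = v[a := \<not> v ! a]"

text \<open>\<open>flip_walk v [a\<^sub>1, \<dots>, a\<^sub>m]\<close> is the vertex sequence of the walk \<open>(v; a\<^sub>1 \<dots> a\<^sub>m)\<close>.\<close>

primrec flip_walk :: "bool list \<Rightarrow> nat list \<Rightarrow> bool list list" where
  "flip_walk v [] = [v]"
| "flip_walk v (a # as) = v # flip_walk (flip a v) as"

text \<open>The vertex of the 3-cube identified with the integer \<open>4 b\<^sub>2 + 2 b\<^sub>1 + b\<^sub>0\<close> is the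
  list \<open>[b\<^sub>0, b\<^sub>1, b\<^sub>2]\<close>: list position \<open>i\<close> holds the \<open>i\<close>-th coordinate, so lists read in the
  opposite direction to the string \<open>b\<^sub>2b\<^sub>1b\<^sub>0\<close>.\<close>

definition q3_vertex :: "nat \<Rightarrow> bool list" where
  "q3_vertex k = map (bit k) [0..<3]"

definition gray_path :: "nat list" where
  "gray_path = [0, 1, 3, 2, 6, 7, 5, 4]"

definition gray_cotree :: "(nat \<times> nat) set" where
  "gray_cotree = {(0, 2), (0, 4), (1, 5), (3, 7), (4, 6)}"

text \<open>The copy of the 3-cube in which coordinate \<open>i\<close> of the 3-cube becomes coordinate \<open>c i\<close>
  and every other coordinate is held at its value in \<open>z\<close>.\<close>

definition copy_vertex :: "(nat \<Rightarrow> nat) \<Rightarrow> bool list \<Rightarrow> bool list \<Rightarrow> bool list" where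
  "copy_vertex c z b = z[c 0 := b ! 0, c 1 := b ! 1, c 2 := b ! 2]"

section \<open>Spanning trees and orientations of cotree edges\<close>

text \<open>The library's \<^const>\<open>tree\<close> forbids all directed cycles, which a symmetric digraph with
  an edge never satisfies: \<open>u \<rightarrow> v \<rightarrow> u\<close> is one. The undirected notion excludes every cycle
  other than these back-and-forth traversals of a single edge.\<close>

definition undirected_tree :: "'a pair_pre_digraph \<Rightarrow> bool" where
  "undirected_tree T \<longleftrightarrow> symmetric (with_proj T) \<and> connected (with_proj T) \<and>
     (\<forall>p. pre_digraph.cycle (with_proj T) p \<longrightarrow> length p = 2)"

definition undirected_spanning_tree :: "'a pair_pre_digraph \<Rightarrow> 'a pair_pre_digraph \<Rightarrow> bool" where
  "undirected_spanning_tree T G \<longleftrightarrow> undirected_tree T \<and> spanning (with_proj T) (with_proj G)"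

text \<open>\<open>D\<close> contains exactly one of the two arcs of each edge of \<open>G\<close> outside \<open>T\<close>, and nothing
  else.\<close>

definition cotree_orientation ::
    "'a pair_pre_digraph \<Rightarrow> 'a pair_pre_digraph \<Rightarrow> ('a \<times> 'a) set \<Rightarrow> bool" where
  "cotree_orientation G T D \<longleftrightarrow> D \<subseteq> parcs G - parcs T \<and>
     (\<forall>(p, q) \<in> parcs G - parcs T. (p, q) \<in> D \<longleftrightarrow> (q, p) \<notin> D)"

section \<open>Free reduction\<close>

text \<open>The letter \<open>(x, True)\<close> is the basis element \<open>x\<close> and \<open>(x, False)\<close> its inverse; elements of
  the free group on a set are the reduced words in these letters over that set.\<close>

type_synonym 'x word = "('x \<times> bool) list"

fun cons_cancel :: "'x \<times> bool \<Rightarrow> 'x word \<Rightarrow> 'x word" where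
  "cons_cancel a [] = [a]"
| "cons_cancel a (b # w) =
     (if fst a = fst b \<and> snd a \<noteq> snd b then w else a # b # w)"

definition free_reduce :: "'x word \<Rightarrow> 'x word" where
  "free_reduce w = foldr cons_cancel w []"

text \<open>The lemmas below identify \<^const>\<open>free_reduce\<close>: it picks out the unique
  reduced word in each class of words modulo insertion and deletion of \<open>x x\<inverse>\<close> and \<open>x\<inverse> x\<close>.\<close>

definition reduced_word :: "'x word \<Rightarrow> bool" where
  "reduced_word w \<longleftrightarrow> (\<nexists>u v x e. w = u @ [(x, e), (x, \<not> e)] @ v)"

inductive cancels :: "'x word \<Rightarrow> 'x word \<Rightarrow> bool" where
  "cancels (u @ [(x, e), (x, \<not> e)] @ v) (u @ v)"

lemma reduced_word_Cons:
  "reduced_word (a # w) \<longleftrightarrow>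
     reduced_word w \<and> (w = [] \<or> \<not> (fst a = fst (hd w) \<and> snd a \<noteq> snd (hd w)))"
  (is "?L \<longleftrightarrow> ?R")
proof
  assume L: ?L
  have "reduced_word w"
    unfolding reduced_word_def
  proof clarify
    fix u v x e assume "w = u @ [(x, e), (x, \<not> e)] @ v"
    then have "a # w = (a # u) @ [(x, e), (x, \<not> e)] @ v" by simp
    with L show False unfolding reduced_word_def by blast
  qed
  moreover have "w = [] \<or> \<not> (fst a = fst (hd w) \<and> snd a \<noteq> snd (hd w))"
  proof (rule ccontr)
    assume "\<not> ?thesis"
    then obtain b w' where "w = b # w'" "fst a = fst b" "snd b = (\<not> snd a)"
      by (cases w) auto
    then have "a # w = [] @ [(fst a, snd a), (fst a, \<not> snd a)] @ w'"
      by (cases a; cases b) simp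
    with L show False unfolding reduced_word_def by blast
  qed
  ultimately show ?R by blast
next
  assume R: ?R
  show ?L
    unfolding reduced_word_def
  proof clarify
    fix u v x e assume eq: "a # w = u @ [(x, e), (x, \<not> e)] @ v"
    show False
    proof (cases u)
      case Nil
      with eq R show False by auto
    next
      case (Cons b u')
      with eq have "w = u' @ [(x, e), (x, \<not> e)] @ v" by simp
      with R show False unfolding reduced_word_def by blast
    qed
  qed
qed

lemma reduced_cons_cancel: "reduced_word w \<Longrightarrow> reduced_word (cons_cancel a w)"
proof (cases w)
  case Nil
  have "reduced_word []" by (simp add: reduced_word_def)
  with Nil show ?thesis by (simp add: reduced_word_Cons)
next
  case (Cons b w')
  assume "reduced_word w"
  with Cons show ?thesis by (simp add: reduced_word_Cons)
qed

lemma reduced_free_reduce: "reduced_word (free_reduce w)"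
proof (induction w)
  case Nil
  show ?case by (simp add: free_reduce_def reduced_word_def)
next
  case (Cons a w)
  then show ?case by (simp add: free_reduce_def reduced_cons_cancel)
qed

lemma free_reduce_id: "reduced_word w \<Longrightarrow> free_reduce w = w"
proof (induction w)
  case Nil
  show ?case by (simp add: free_reduce_def)
next
  case (Cons a w)
  then have "free_reduce w = w" by (simp add: reduced_word_Cons)
  with Cons.prems show ?case
    by (cases w) (auto simp: free_reduce_def reduced_word_Cons)
qed

lemma cons_cancel_inverse:
  "reduced_word w \<Longrightarrow> cons_cancel (x, e) (cons_cancel (x, \<not> e) w) = w"
proof (cases w)
  case (Cons b w')
  assume "reduced_word w"
  with Cons show ?thesis
    by (cases w'; cases b) (auto simp: reduced_word_Cons)
qed simp

lemma cancels_free_reduce: "cancels w w' \<Longrightarrow> free_reduce w = free_reduce w'"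
proof (induction rule: cancels.induct)
  case (1 u x e v)
  have "cons_cancel (x, e) (cons_cancel (x, \<not> e) (foldr cons_cancel v [])) = foldr cons_cancel v []"
    by (rule cons_cancel_inverse[OF reduced_free_reduce[of v, unfolded free_reduce_def]])
  then show ?case by (simp add: free_reduce_def)
qed

lemma cancels_Cons: "cancels w w' \<Longrightarrow> cancels (a # w) (a # w')"
proof (induction rule: cancels.induct)
  case (1 u x e v)
  show ?case using cancels.intros[of "a # u" x e v] by simp
qed

lemma cancels_to_free_reduce: "cancels\<^sup>*\<^sup>* w (free_reduce w)"
proof (induction w)
  case Nil
  show ?case by (simp add: free_reduce_def)
next
  case (Cons a w)
  have "cancels\<^sup>*\<^sup>* (a # w) (a # free_reduce w)"
    using Cons.IH by (induction rule: rtranclp_induct)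
      (auto intro: rtranclp.rtrancl_into_rtrancl dest: cancels_Cons)
  moreover have "cancels\<^sup>*\<^sup>* (a # r) (cons_cancel a r)" for r
  proof (cases r)
    case (Cons b r')
    have "cancels (a # b # r') r'" if "fst a = fst b" "snd a \<noteq> snd b"
    proof -
      have "a # b # r' = [] @ [(fst a, snd a), (fst a, \<not> snd a)] @ r'"
        using that by (cases a; cases b) auto
      then show ?thesis using cancels.intros[of "[]" "fst a" "snd a" r'] by simp
    qed
    with Cons show ?thesis by auto
  qed simp
  ultimately show ?case
    by (simp add: free_reduce_def) (meson rtranclp_trans)
qed

section \<open>Closed walks, transition counts and loop words\<close>

definition based_closed_walk :: "'a pair_pre_digraph \<Rightarrow> 'a \<Rightarrow> 'a vwalk \<Rightarrow> bool" where
  "based_closed_walk G x w \<longleftrightarrow> vwalk w (with_proj G) \<and> hd w = x \<and> last w = x"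

definition transition_count :: "'a vwalk \<Rightarrow> 'a \<Rightarrow> 'a \<Rightarrow> nat" where
  "transition_count w p q = card {k. 1 \<le> k \<and> k < length w \<and> (w ! (k - 1), w ! k) = (p, q)}"

text \<open>The basis elements are the chosen arcs of the cotree edges. A tree edge has neither of its
  arcs in \<open>D\<close>.\<close>

definition crossing :: "('a \<times> 'a) set \<Rightarrow> 'a \<times> 'a \<Rightarrow> ('a \<times> 'a) word" where
  "crossing D = (\<lambda>(p, q). if (p, q) \<in> D then [((p, q), True)]
                         else if (q, p) \<in> D then [((q, p), False)] else [])"

definition loop_word :: "('a \<times> 'a) set \<Rightarrow> 'a vwalk \<Rightarrow> ('a \<times> 'a) word" where
  "loop_word D w = free_reduce (concat (map (crossing D) (vwalk_arcs w)))"

end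

theory Submission
  imports Defs
begin

text \<open>Both walks are concatenations of the same two closed walks at one vertex. Joining two closed
  walks concatenates their arc lists, so the two orders use the same arcs equally often
  (\<open>transition_count_join_commute\<close>). The signed cotree crossings, by contrast, come in a definite
  order. Write \<open>a = (0,2)\<close>, \<open>b = (0,4)\<close>, \<open>e = (4,6)\<close> for the three cotree edges that are met. The walk
  \<open>A\<close> visits \<open>0,1,3,2,0\<close> and reads \<open>a\<inverse>\<close>; the walk \<open>B\<close> visits \<open>0,2,6,4,0\<close> and
  reads \<open>a e\<inverse> b\<inverse>\<close>. Hence \<open>AB\<close> reads \<open>a\<inverse> a e\<inverse> b\<inverse>\<close>, which reduces to \<open>e\<inverse> b\<inverse>\<close>, while \<open>BA\<close> reads
  \<open>a e\<inverse> b\<inverse> a\<inverse>\<close>. Its only adjacent letters of opposite sign are the first two, which do not cancel: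
  the embedding of the 3-cube is injective (\<open>copy_vertex_inject\<close>), so \<open>a\<close> and \<open>e\<close> stay distinct in
  \<open>Q\<^sub>n\<close>. The reduced words thus have lengths 2 and 4. A function of the transition counts would take
  the same value on both walks, so none computes the loop word.\<close>

lemma transition_count_conv_count_list:
  "transition_count w p q = count_list (vwalk_arcs w) (p, q)"
proof -
  have nth: "vwalk_arcs w ! k = (w ! k, w ! Suc k)" if "Suc k < length w" for k
    using that by (induction w arbitrary: k rule: vwalk_arcs.induct) (auto simp: nth_Cons')
  have len: "length (vwalk_arcs w) = length w - 1"
    by (fold vwalk_length_def) (rule vwalk_length_simp)
  have "{k. 1 \<le> k \<and> k < length w \<and> (w ! (k - 1), w ! k) = (p, q)} =
        Suc ` {k. k < length (vwalk_arcs w) \<and> vwalk_arcs w ! k = (p, q)}" (is "?L = Suc ` ?R")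
  proof (intro equalityI subsetI)
    fix k assume k: "k \<in> ?L"
    then obtain j where "k = Suc j" by (cases k) auto
    with k show "k \<in> Suc ` ?R" by (auto simp: nth len)
  qed (auto simp: nth len)
  then have "transition_count w p q = card ?R"
    by (simp add: transition_count_def card_image)
  also have "\<dots> = count_list (vwalk_arcs w) (p, q)"
    by (simp add: count_list_eq_length_filter length_filter_conv_card eq_commute)
  finally show ?thesis .
qed

lemma transition_count_join_commute:
  assumes "joinable p q" "joinable q p"
  shows "transition_count (vwalk_join p q) = transition_count (vwalk_join q p)"
  using assms by (simp add: fun_eq_iff transition_count_conv_count_list vwalk_join_arcs add.commute)

lemma based_closed_walk_join:
  assumes "based_closed_walk G x p" "based_closed_walk G x q"
  shows "based_closed_walk G x (vwalk_join p q)"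
proof -
  have "joinable p q"
    using assms by (auto simp: based_closed_walk_def joinable_def vwalk_def)
  with assms show ?thesis
    by (auto simp: based_closed_walk_def vwalk_join_hd vwalk_join_last intro: vwalk_joinI_vwalk)
qed

lemma length_flip [simp]: "length (flip a v) = length v"
  by (simp add: flip_def)

lemma flip_arc_cube:
  assumes "length v = n" "a < n"
  shows "(v, flip a v) \<in> parcs (cube n)"
  using assms by (auto simp: cube_def flip_def nth_list_update intro!: ex1I[of _ a])

lemma vwalk_flip_walk:
  assumes "length v = n" "set as \<subseteq> {..<n}"
  shows "vwalk (flip_walk v as) (with_proj (cube n))"
  using assms
proof (induction as arbitrary: v)
  case Nil
  then show ?case by (simp add: vwalk_def cube_def)
next
  case (Cons a as)
  have "hd (flip_walk (flip a v) as) = flip a v" by (cases as) simp_all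
  with Cons show ?case
    by (auto intro!: vwalk_consI simp: flip_arc_cube) (simp add: cube_def)
qed

lemma length_q3_vertex [simp]: "length (q3_vertex k) = 3"
  by (simp add: q3_vertex_def)

lemma copy_coordinates:
  fixes c :: "nat \<Rightarrow> nat"
  assumes "inj_on c {..<3}" "c ` {..<3} \<subseteq> {..<m}"
  shows "c 0 \<noteq> c 1" "c 0 \<noteq> c 2" "c 1 \<noteq> c 2" "c 0 < m" "c 1 < m" "c 2 < m"
proof -
  have "{..<3} = {0, 1, 2 :: nat}" by auto
  with assms show "c 0 \<noteq> c 1" "c 0 \<noteq> c 2" "c 1 \<noteq> c 2" "c 0 < m" "c 1 < m" "c 2 < m"
    by simp_all
qed

text \<open>Coordinate \<open>i\<close> of the 3-cube can be read off from coordinate \<open>c i\<close> of the copy.\<close>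

lemma nth_copy_vertex:
  assumes "inj_on c {..<3}" "c ` {..<3} \<subseteq> {..<length z}" "i < 3"
  shows "copy_vertex c z b ! c i = b ! i"
proof -
  have "i = 0 \<or> i = 1 \<or> i = 2" using assms(3) by auto
  with copy_coordinates[OF assms(1,2)] show ?thesis by (auto simp: copy_vertex_def)
qed

lemma copy_vertex_inject:
  assumes "inj_on c {..<3}" "c ` {..<3} \<subseteq> {..<length z}" "length b = 3" "length b' = 3"
  shows "copy_vertex c z b = copy_vertex c z b' \<longleftrightarrow> b = b'"
proof
  assume eq: "copy_vertex c z b = copy_vertex c z b'"
  have "b ! i = b' ! i" if "i < 3" for i
    using nth_copy_vertex[OF assms(1,2) that, of b] nth_copy_vertex[OF assms(1,2) that, of b'] eq
    by simp
  with assms(3,4) show "b = b'" by (simp add: nth_equalityI)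
qed simp

lemma copy_vertex_flip:
  assumes "inj_on c {..<3}" "c ` {..<3} \<subseteq> {..<length z}" "length b = 3" "a < 3"
  shows "copy_vertex c z (flip a b) = flip (c a) (copy_vertex c z b)"
proof -
  have "a = 0 \<or> a = 1 \<or> a = 2" using assms(4) by auto
  with copy_coordinates[OF assms(1,2)] assms(3) show ?thesis
    by (auto simp: copy_vertex_def flip_def nth_list_update intro!: nth_equalityI)
qed

lemma map_copy_vertex_flip_walk:
  assumes "inj_on c {..<3}" "c ` {..<3} \<subseteq> {..<length z}" "length b = 3" "set as \<subseteq> {..<3}"
  shows "map (copy_vertex c z) (flip_walk b as) = flip_walk (copy_vertex c z b) (map c as)"
  using assms by (induction as arbitrary: b) (auto simp: copy_vertex_flip)

lemma crossing_cotree: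
  assumes "cotree_orientation G T D" "(p, q) \<in> D"
  shows "crossing D (p, q) = [((p, q), True)]" "crossing D (q, p) = [((p, q), False)]"
  using assms by (auto simp: cotree_orientation_def crossing_def)

lemma crossing_tree:
  assumes "undirected_tree T" "cotree_orientation G T D" "(p, q) \<in> parcs T"
  shows "crossing D (p, q) = []" "crossing D (q, p) = []"
proof -
  have "(q, p) \<in> parcs T"
    using assms(1,3) by (auto simp: undirected_tree_def symmetric_def dest: symD)
  with assms(2,3) show "crossing D (p, q) = []" "crossing D (q, p) = []"
    by (auto simp: cotree_orientation_def crossing_def)
qed

theorem mainTheorem5:
  fixes n :: nat
    and c :: "nat \<Rightarrow> nat" and z x0 :: "bool list"
    and T :: "bool list pair_pre_digraph" and D :: "(bool list \<times> bool list) set"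
    and A B w_AB w_BA :: "bool list vwalk"
  assumes "n \<ge> 3"
    and "inj_on c {..<3}" and "c ` {..<3} \<subseteq> {..<n}" and "z \<in> pverts (cube n)"
    and "x0 = copy_vertex c z (q3_vertex 0)"
    and "undirected_spanning_tree T (cube n)"
    and "set (vwalk_arcs (map (\<lambda>k. copy_vertex c z (q3_vertex k)) gray_path)) \<subseteq> parcs T"
    and "cotree_orientation (cube n) T D"
    and "\<And>j k. (j, k) \<in> gray_cotree \<Longrightarrow>
           (copy_vertex c z (q3_vertex j), copy_vertex c z (q3_vertex k)) \<in> D"
    and "A = map (copy_vertex c z) (flip_walk (q3_vertex 0) [0, 1, 0, 1])"
    and "B = map (copy_vertex c z) (flip_walk (q3_vertex 0) [1, 2, 1, 2])"
    and "w_AB = vwalk_join A B" and "w_BA = vwalk_join B A"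
  shows "based_closed_walk (cube n) x0 w_AB \<and> based_closed_walk (cube n) x0 w_BA \<and>
    transition_count w_AB = transition_count w_BA \<and>
    loop_word D w_AB \<noteq> loop_word D w_BA \<and>
    \<not> (\<exists>f. \<forall>w. based_closed_walk (cube n) x0 w \<longrightarrow> loop_word D w = f (transition_count w))"
proof -
  define V where "V k = copy_vertex c z (q3_vertex k)" for k
  have len_z: "length z = n" using assms(4) by (simp add: cube_def)
  have c_less: "c ` {..<3} \<subseteq> {..<length z}" using assms(3) len_z by simp
  note copy = assms(2) c_less

  have A: "A = map V [0, 1, 3, 2, 0]"
    unfolding assms(10) V_def by (simp add: flip_def q3_vertex_def upt_rec bit_0)
  have B: "B = map V [0, 2, 6, 4, 0]"
    unfolding assms(11) V_def by (simp add: flip_def q3_vertex_def upt_rec bit_0)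

  have walk: "vwalk (map (copy_vertex c z) (flip_walk (q3_vertex 0) as)) (with_proj (cube n))"
    if "set as \<subseteq> {..<3}" for as
    unfolding map_copy_vertex_flip_walk[OF copy length_q3_vertex that]
    using that assms(3) by (intro vwalk_flip_walk) (auto simp: copy_vertex_def len_z)
  have x0: "x0 = V 0" using assms(5) by (simp add: V_def)
  have closed: "based_closed_walk (cube n) x0 A" "based_closed_walk (cube n) x0 B"
    using walk[of "[0, 1, 0, 1]"] walk[of "[1, 2, 1, 2]"]
    unfolding assms(10,11)[symmetric] by (simp_all add: based_closed_walk_def x0 A B)
  have joinable: "joinable A B" "joinable B A" by (simp_all add: joinable_def A B)

  have closed_joins: "based_closed_walk (cube n) x0 w_AB" "based_closed_walk (cube n) x0 w_BA"
    unfolding assms(12,13) using closed by (simp_all add: based_closed_walk_join)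
  have counts: "transition_count w_AB = transition_count w_BA"
    unfolding assms(12,13) using joinable by (rule transition_count_join_commute)

  have tree: "undirected_tree T" using assms(6) by (simp add: undirected_spanning_tree_def)
  have "(V 0, V 1) \<in> parcs T" "(V 1, V 3) \<in> parcs T" "(V 3, V 2) \<in> parcs T" "(V 2, V 6) \<in> parcs T"
    using assms(7) by (simp_all add: gray_path_def V_def)
  note on_tree = this[THEN crossing_tree(1)[OF tree assms(8)]]
  have "(V 0, V 2) \<in> D" "(V 0, V 4) \<in> D" "(V 4, V 6) \<in> D"
    unfolding V_def by (rule assms(9), simp add: gray_cotree_def)+
  note off_tree = this[THEN crossing_cotree(1)[OF assms(8)]] this[THEN crossing_cotree(2)[OF assms(8)]]

  have "q3_vertex 0 \<noteq> q3_vertex 4"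
    by (simp add: q3_vertex_def upt_rec bit_0)
  then have distinct: "V 0 \<noteq> V 4"
    by (simp add: V_def copy_vertex_inject[OF copy])
  have word_AB: "loop_word D w_AB = [((V 4, V 6), False), ((V 0, V 4), False)]"
    unfolding assms(12) loop_word_def vwalk_join_arcs[OF joinable(1)]
    by (simp add: A B on_tree off_tree free_reduce_def del: One_nat_def)
  \<comment> \<open>The only adjacent letters of opposite sign are the first two, on the cotree edges \<open>(0,2)\<close> and
    \<open>(4,6)\<close>, which have different starting vertices.\<close>
  have word_BA: "loop_word D w_BA =
      [((V 0, V 2), True), ((V 4, V 6), False), ((V 0, V 4), False), ((V 0, V 2), False)]"
    using distinct unfolding assms(13) loop_word_def vwalk_join_arcs[OF joinable(2)]
    by (simp add: A B on_tree off_tree free_reduce_def del: One_nat_def)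
  have "loop_word D w_AB \<noteq> loop_word D w_BA" by (simp add: word_AB word_BA)
  with closed_joins counts show ?thesis by metis
qed

end
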